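(* Let $d\in\mathbb{N}$, $0<p_1\le u_1<\infty$ and $0<p_2\le u_2<\infty$. Then the embedding $$m_{u_1,p_1}(\mathbb{Z}^d)\hookrightarrow m_{u_2,p_2}(\mathbb{Z}^d)$$ is continuous if, and only if, the following conditions hold: $$u_1\le u_2\qquad\text{and}\qquad \frac{p_2}{u_2}\le\frac{p_1}{u_1}.$$ The embedding is never compact.
   Context: For $j\in\mathbb{Z}$, $m\in\mathbb{Z}^d$, the dyadic cubes are $Q_{j,m}=2^{-j}(m+[0,1)^d)\subset\mathbb{R}^d$; $|\cdot|$ applied to a cube is Lebesgue measure, so $|Q_{-j,m}|=2^{jd}$. For $0<p\le u<\infty$, the Morrey sequence space $m_{u,p}(\mathbb{Z}^d)$ consists of all $\lambda=\{\lambda_k\}_{k\in\mathbb{Z}^d}\subset\mathbb{C}$ with $$\|\lambda|m_{u,p}\|=\sup_{j\in\mathbb{N}_0,\,m\in\mathbb{Z}^d}|Q_{-j,m}|^{\frac1u-\frac1p}\Big(\sum_{k:\,Q_{0,k}\subset Q_{-j,m}}|\lambda_k|^p\Big)^{1/p}<\infty ,$$ a (quasi-)norm. For (quasi-)Banach spaces, $X\hookrightarrow Y$ means that $X\subset Y$ and the natural embedding (inclusion map) is continuous. "Never compact" means that whenever the embedding exists as a continuous inclusion, it is not a compact operator. *)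

theory Defs
  imports "HOL-Analysis.Analysis"
begin

definition dyadic_cube :: "int \<Rightarrow> int ^ 'd \<Rightarrow> (real ^ 'd) set"
  where "dyadic_cube j m =
    (\<lambda>y. (2 powi (- j)) *\<^sub>R ((\<chi> i. real_of_int (m $ i)) + y)) ` {y. \<forall>i. 0 \<le> y $ i \<and> y $ i < 1}"

lemma mem_dyadic_cube:
  "x \<in> dyadic_cube j m \<longleftrightarrow>
    (\<forall>i. 2 powi (- j) * real_of_int (m $ i) \<le> x $ i \<and> x $ i < 2 powi (- j) * (real_of_int (m $ i) + 1))"
    (is "_ \<longleftrightarrow> ?R")
proof
  assume "x \<in> dyadic_cube j m"
  then show ?R by (auto simp: dyadic_cube_def)
next
  assume R: ?R
  define c :: real where "c = 2 powi (- j)"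
  have c: "c > 0" by (simp add: c_def)
  define y :: "real ^ 'a" where "y = (\<chi> i. x $ i / c - real_of_int (m $ i))"
  have "\<forall>i. 0 \<le> y $ i \<and> y $ i < 1"
    using R c unfolding c_def[symmetric] y_def by (simp add: field_simps)
  moreover have "x = c *\<^sub>R ((\<chi> i. real_of_int (m $ i)) + y)"
    using c by (simp add: vec_eq_iff y_def)
  ultimately show "x \<in> dyadic_cube j m"
    unfolding dyadic_cube_def c_def[symmetric] by blast
qed

text \<open>The sum in the Morrey norm runs over a finite set, so it is a genuine finite sum.\<close>

lemma finite_unit_cubes_in_dyadic_cube:
  "finite {k. dyadic_cube 0 k \<subseteq> dyadic_cube j (m :: int ^ 'd)}"
proof (rule finite_subset)
  let ?c = "2 powi (- j) :: real"
  let ?P = "\<lambda>i k. k \<in> {\<lfloor>?c * real_of_int (m $ i)\<rfloor>..\<lceil>?c * (real_of_int (m $ i) + 1)\<rceil>}"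
  show "finite {k :: int ^ 'd. \<forall>i. ?P i (k $ i)}"
  proof (rule finite_surj)
    show "finite (PiE (UNIV :: 'd set) (\<lambda>i. Collect (?P i)))"
      by (rule finite_PiE) simp_all
    show "{k :: int ^ 'd. \<forall>i. ?P i (k $ i)} \<subseteq> (\<lambda>f. \<chi> i. f i) ` PiE UNIV (\<lambda>i. Collect (?P i))"
    proof
      fix k :: "int ^ 'd" assume "k \<in> {k. \<forall>i. ?P i (k $ i)}"
      then show "k \<in> (\<lambda>f. \<chi> i. f i) ` PiE UNIV (\<lambda>i. Collect (?P i))"
        by (intro image_eqI[of _ _ "vec_nth k"]) (simp_all add: PiE_iff)
    qed
  qed
  show "{k. dyadic_cube 0 k \<subseteq> dyadic_cube j m} \<subseteq> {k. \<forall>i. ?P i (k $ i)}"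
  proof safe
    fix k i assume "dyadic_cube 0 k \<subseteq> dyadic_cube j m"
    moreover have "(\<chi> i. real_of_int (k $ i)) \<in> dyadic_cube 0 k"
      by (simp add: mem_dyadic_cube)
    ultimately have "(\<chi> i. real_of_int (k $ i)) \<in> dyadic_cube j m" by blast
    then have "?c * real_of_int (m $ i) \<le> real_of_int (k $ i)"
      "real_of_int (k $ i) < ?c * (real_of_int (m $ i) + 1)"
      by (simp_all add: mem_dyadic_cube)
    then show "?P i (k $ i)"
      by (simp add: floor_le_iff le_ceiling_iff)
  qed
qed

text \<open>The value is \<open>\<infinity>\<close> exactly for sequences outside the Morrey space
  (\<open>Morrey_space u p = {x. Morrey_norm u p x < \<infinity>}\<close>).\<close>

definition Morrey_norm :: "real \<Rightarrow> real \<Rightarrow> (int ^ 'd \<Rightarrow> complex) \<Rightarrow> ennreal"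
  where "Morrey_norm u p x =
    (SUP j :: nat. SUP m :: int ^ 'd.
      ennreal (measure lborel (dyadic_cube (- int j) m) powr (1 / u - 1 / p) *
        (\<Sum>k | dyadic_cube 0 k \<subseteq> dyadic_cube (- int j) m. cmod (x k) powr p) powr (1 / p)))"

definition finite_part :: "('a \<Rightarrow> ennreal) \<Rightarrow> 'a set"
  where "finite_part N = {x. N x < \<infinity>}"

text \<open>Quasi-norms satisfy the triangle inequality only up to a constant, so they do not induce
  a metric directly. The topology is the usual one: a set is open iff with each of its points it
  contains some ball around that point.\<close>

definition quasinorm_topology :: "('a :: minus \<Rightarrow> ennreal) \<Rightarrow> 'a topology"
  where "quasinorm_topology N =
    topology (\<lambda>U. U \<subseteq> finite_part N \<and>
      (\<forall>x\<in>U. \<exists>r>0. {y \<in> finite_part N. N (y - x) < ennreal r} \<subseteq> U))"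

lemma openin_quasinorm_topology:
  "openin (quasinorm_topology N) U \<longleftrightarrow> U \<subseteq> finite_part N \<and>
    (\<forall>x\<in>U. \<exists>r>0. {y \<in> finite_part N. N (y - x) < ennreal r} \<subseteq> U)"
proof -
  let ?P = "\<lambda>U. U \<subseteq> finite_part N \<and>
    (\<forall>x\<in>U. \<exists>r>0. {y \<in> finite_part N. N (y - x) < ennreal r} \<subseteq> U)"
  have "istopology ?P"
    unfolding istopology_def
  proof (intro conjI allI impI)
    fix S T assume S: "?P S" and T: "?P T"
    show "S \<inter> T \<subseteq> finite_part N" using S by blast
    show "\<forall>x\<in>S \<inter> T. \<exists>r>0. {y \<in> finite_part N. N (y - x) < ennreal r} \<subseteq> S \<inter> T"
    proof
      fix x assume "x \<in> S \<inter> T"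
      then obtain r s where r: "r > 0" "{y \<in> finite_part N. N (y - x) < ennreal r} \<subseteq> S"
        and s: "s > 0" "{y \<in> finite_part N. N (y - x) < ennreal s} \<subseteq> T"
        using S T by blast
      have "ennreal (min r s) \<le> ennreal r" "ennreal (min r s) \<le> ennreal s"
        by (simp_all add: ennreal_leI)
      with r s have "{y \<in> finite_part N. N (y - x) < ennreal (min r s)} \<subseteq> S \<inter> T"
        by (blast dest: less_le_trans)
      with r s show "\<exists>r>0. {y \<in> finite_part N. N (y - x) < ennreal r} \<subseteq> S \<inter> T"
        by (intro exI[of _ "min r s"]) simp
    qed
  next
    fix \<K> assume K: "\<forall>K\<in>\<K>. ?P K"
    show "\<Union>\<K> \<subseteq> finite_part N" using K by blast
    show "\<forall>x\<in>\<Union>\<K>. \<exists>r>0. {y \<in> finite_part N. N (y - x) < ennreal r} \<subseteq> \<Union>\<K>"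
    proof
      fix x assume "x \<in> \<Union>\<K>"
      then obtain K where "K \<in> \<K>" "x \<in> K" by blast
      moreover from this K obtain r where "r > 0" "{y \<in> finite_part N. N (y - x) < ennreal r} \<subseteq> K"
        by meson
      ultimately show "\<exists>r>0. {y \<in> finite_part N. N (y - x) < ennreal r} \<subseteq> \<Union>\<K>"
        by blast
    qed
  qed
  then show ?thesis
    by (simp add: quasinorm_topology_def topology_inverse')
qed

lemma topspace_quasinorm_topology: "topspace (quasinorm_topology N) = finite_part N"
proof -
  have "openin (quasinorm_topology N) (finite_part N)"
    unfolding openin_quasinorm_topology by (auto intro!: exI[of _ 1])
  then show ?thesis
    by (metis openin_quasinorm_topology openin_subset openin_topspace subset_antisym)
qed

definition continuously_embedded :: "('a :: minus \<Rightarrow> ennreal) \<Rightarrow> ('a \<Rightarrow> ennreal) \<Rightarrow> bool"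
  where "continuously_embedded N\<^sub>1 N\<^sub>2 \<longleftrightarrow>
    finite_part N\<^sub>1 \<subseteq> finite_part N\<^sub>2 \<and>
    continuous_map (quasinorm_topology N\<^sub>1) (quasinorm_topology N\<^sub>2) (\<lambda>x. x)"

text \<open>For linear \<open>T\<close>; every set that is bounded in quasi-norm is mapped to a relatively compact set.\<close>

definition compact_operator :: "('a :: minus \<Rightarrow> ennreal) \<Rightarrow> ('b :: minus \<Rightarrow> ennreal) \<Rightarrow> ('a \<Rightarrow> 'b) \<Rightarrow> bool"
  where "compact_operator N\<^sub>1 N\<^sub>2 T \<longleftrightarrow>
    T ` finite_part N\<^sub>1 \<subseteq> finite_part N\<^sub>2 \<and>
    (\<forall>B c. (\<forall>x\<in>B. N\<^sub>1 x \<le> ennreal c) \<longrightarrow>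
      compactin (quasinorm_topology N\<^sub>2) (quasinorm_topology N\<^sub>2 closure_of (T ` B)))"

end

theory Submission
  imports Defs
begin

text \<open>
  Write \<open>N\<^sub>i\<close> for \<open>Morrey_norm u\<^sub>i p\<^sub>i\<close>. Cubes of side 1 give \<open>\<bar>x\<^sub>k\<bar> \<le> N\<^sub>i x\<close>.

  Sufficiency: put \<open>p = p\<^sub>1 u\<^sub>2 / u\<^sub>1\<close>, so \<open>p \<ge> p\<^sub>1\<close> and \<open>p \<ge> p\<^sub>2\<close>. On a cube, bounding \<open>\<bar>x\<^sub>k\<bar>\<close> by \<open>N\<^sub>1 x\<close> in
  \<open>\<bar>x\<^sub>k\<bar> powr (p - p\<^sub>1)\<close> passes from exponents \<open>(u\<^sub>1, p\<^sub>1)\<close> to \<open>(u\<^sub>2, p)\<close>, since \<open>p\<^sub>1 / u\<^sub>1 = p / u\<^sub>2\<close>, and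
  the power mean inequality passes from \<open>p\<close> down to \<open>p\<^sub>2\<close>. Hence \<open>N\<^sub>2 \<le> N\<^sub>1\<close>.

  Necessity: the indicator of the lattice \<open>2^s \<int>\<^sup>d\<close> intersected with the cube \<open>[0, 2^n)\<^sup>d\<close> has
  \<open>N\<^sub>1 \<le> 2 powr (d * max 0 (n/u\<^sub>1 - s/p\<^sub>1))\<close> and \<open>N\<^sub>2 \<ge> 2 powr (d * (n/u\<^sub>2 - s/p\<^sub>2))\<close>. The choices
  \<open>s = 0\<close> and \<open>s = \<lceil>n p\<^sub>1 / u\<^sub>1\<rceil>\<close> make the ratio \<open>N\<^sub>2 / N\<^sub>1\<close> unbounded when the first, respectively the
  second, condition fails. After scaling, \<open>N\<^sub>1 (y\<^sub>n) \<longlonglongrightarrow> 0\<close> while \<open>N\<^sub>2 (y\<^sub>n) \<ge> 1\<close>. Then \<open>{y\<^sub>n}\<close> is closed for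
  \<open>N\<^sub>2\<close>: it stays away from \<open>0\<close>, and from every other point already in the supremum norm. So the
  inclusion is not continuous at \<open>0\<close>.

  Compactness fails because the unit sequences have \<open>N\<^sub>1 \<le> 1\<close> but mutual supremum distance 1.
\<close>

section \<open>Topologies of quasi-norms: separated sets, continuity and compactness\<close>

lemma ennreal_min_le:
  assumes "ennreal r \<le> a \<or> ennreal s \<le> a"
  shows "ennreal (min r s) \<le> a"
  using assms by (meson ennreal_leI min.cobounded1 min.cobounded2 order_trans)

text \<open>Turns finitely many positive distances into one ball radius. Radii are real while
  distances may be infinite, so an infinite value is replaced by 1.\<close>

lemma finite_positive_lower_bound:
  assumes "finite F" and "\<And>y. y \<in> F \<Longrightarrow> 0 < (f y :: ennreal)"
  shows "\<exists>r>0. \<forall>y\<in>F. ennreal r \<le> f y"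
  using assms
proof (induction F rule: finite_induct)
  case empty
  show ?case by (auto intro!: exI[of _ 1])
next
  case (insert a F)
  then obtain r where r: "r > 0" "\<forall>y\<in>F. ennreal r \<le> f y" by auto
  obtain s where s: "s > 0" "ennreal s \<le> f a"
  proof (cases "f a")
    case (real s)
    with insert.prems[of a] that[of s] show ?thesis by (auto simp: ennreal_zero_less_top)
  next
    case top
    then show ?thesis using that[of 1] by simp
  qed
  from r s show ?case
    by (intro exI[of _ "min r s"]) (auto intro: ennreal_min_le)
qed

text \<open>Balls of a quasi-norm need not be open, so closedness of \<open>T\<close> is read off
  the definition of the topology: each point has a ball that meets \<open>T\<close> at most in that
  point.\<close>

lemma openin_diff_separated:
  assumes "\<And>z. z \<in> finite_part N \<Longrightarrow> \<exists>r>0. \<forall>y\<in>T. y \<noteq> z \<longrightarrow> ennreal r \<le> N (y - z)"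
  shows "openin (quasinorm_topology N) (finite_part N - T)"
  unfolding openin_quasinorm_topology
proof (intro conjI ballI)
  fix z assume z: "z \<in> finite_part N - T"
  then obtain r where "r > 0" "\<forall>y\<in>T. y \<noteq> z \<longrightarrow> ennreal r \<le> N (y - z)"
    using assms by blast
  with z show "\<exists>r>0. {y \<in> finite_part N. N (y - z) < ennreal r} \<subseteq> finite_part N - T"
    by (intro exI[of _ r]) (auto simp: not_less[symmetric])
qed blast

text \<open>An \<open>N\<^sub>1\<close>-ball is contained in the \<open>N\<^sub>2\<close>-ball of
  the same centre and radius.\<close>

lemma continuously_embedded_if_le:
  assumes "\<And>x. N\<^sub>2 x \<le> N\<^sub>1 x"
  shows "continuously_embedded N\<^sub>1 N\<^sub>2"
proof -
  have sub: "finite_part N\<^sub>1 \<subseteq> finite_part N\<^sub>2"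
    using assms by (auto simp: finite_part_def intro: le_less_trans)
  have "openin (quasinorm_topology N\<^sub>1) {x \<in> finite_part N\<^sub>1. x \<in> U}"
    if U: "openin (quasinorm_topology N\<^sub>2) U" for U
    unfolding openin_quasinorm_topology
  proof (intro conjI ballI)
    fix x assume "x \<in> {x \<in> finite_part N\<^sub>1. x \<in> U}"
    then obtain r where "r > 0" "{y \<in> finite_part N\<^sub>2. N\<^sub>2 (y - x) < ennreal r} \<subseteq> U"
      using U unfolding openin_quasinorm_topology by blast
    then show "\<exists>r>0. {y \<in> finite_part N\<^sub>1. N\<^sub>1 (y - x) < ennreal r} \<subseteq> {x \<in> finite_part N\<^sub>1. x \<in> U}"
      using sub assms by (intro exI[of _ r]) (auto intro: le_less_trans)
  qed blast
  with sub show ?thesis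
    by (auto simp: continuously_embedded_def continuous_map_def topspace_quasinorm_topology)
qed

text \<open>The preimage of the complement of \<open>range Y\<close> would be an
  \<open>N\<^sub>1\<close>-neighbourhood of 0, although \<open>Y n\<close> tends to 0 in
  \<open>N\<^sub>1\<close>. That this complement is open for \<open>N\<^sub>2\<close> follows from
  the coordinate bounds \<open>dom1\<close> and \<open>dom2\<close>.\<close>

lemma not_continuously_embedded:
  fixes N\<^sub>1 N\<^sub>2 :: "('a \<Rightarrow> complex) \<Rightarrow> ennreal"
  assumes dom1: "\<And>x k. ennreal (cmod (x k)) \<le> N\<^sub>1 x"
    and dom2: "\<And>x k. ennreal (cmod (x k)) \<le> N\<^sub>2 x"
    and zero: "N\<^sub>1 (\<lambda>_. 0) = 0" "N\<^sub>2 (\<lambda>_. 0) = 0"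
    and small: "\<And>n :: nat. \<exists>y. N\<^sub>1 y \<le> ennreal (1 / real (Suc n)) \<and> 1 \<le> N\<^sub>2 y"
  shows "\<not> continuously_embedded N\<^sub>1 N\<^sub>2"
proof
  assume emb: "continuously_embedded N\<^sub>1 N\<^sub>2"
  obtain Y where Y1: "\<And>n. N\<^sub>1 (Y n) \<le> ennreal (1 / real (Suc n))" and Y2: "\<And>n. 1 \<le> N\<^sub>2 (Y n)"
    using small by metis
  have pos: "0 < N\<^sub>2 (y - z)" if "y \<noteq> z" for y z
  proof -
    from that obtain k where "y k \<noteq> z k" by blast
    then have "0 < ennreal (cmod ((y - z) k))" by simp
    also have "\<dots> \<le> N\<^sub>2 (y - z)" by (rule dom2)
    finally show ?thesis .
  qed
  have "openin (quasinorm_topology N\<^sub>2) (finite_part N\<^sub>2 - range Y)"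
  proof (rule openin_diff_separated)
    fix z :: "'a \<Rightarrow> complex"
    show "\<exists>r>0. \<forall>y\<in>range Y. y \<noteq> z \<longrightarrow> ennreal r \<le> N\<^sub>2 (y - z)"
    proof (cases "z = (\<lambda>_. 0)")
      case True
      then have "y - z = y" for y by (simp add: fun_eq_iff)
      then show ?thesis using Y2 by (intro exI[of _ 1]) auto
    next
      case False
      then obtain k where k: "z k \<noteq> 0" by blast
      \<comment> \<open>Coordinate \<open>k\<close> of \<open>Y n\<close> is eventually at most half
        of \<open>cmod (z k)\<close>, which leaves a distance of at least the other half.\<close>
      define a where "a = cmod (z k) / 2"
      have a: "a > 0" using k by (simp add: a_def)
      obtain n0 where n0: "inverse (real (Suc n0)) < a" using reals_Archimedean[OF a] by blast
      have far: "ennreal a \<le> N\<^sub>2 (Y n - z)" if "n \<ge> n0" for n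
      proof -
        have "ennreal (cmod (Y n k)) \<le> ennreal (1 / real (Suc n))"
          using dom1 Y1 by (rule order_trans)
        then have "cmod (Y n k) \<le> 1 / real (Suc n)" by (simp add: ennreal_le_iff)
        also have "\<dots> \<le> 1 / real (Suc n0)" using that by (simp add: frac_le)
        also have "\<dots> \<le> a" using n0 by (simp add: inverse_eq_divide)
        finally have "cmod (Y n k) \<le> a" .
        then have "a \<le> cmod ((Y n - z) k)"
          using norm_triangle_ineq2[of "z k" "Y n k"] by (simp add: a_def norm_minus_commute)
        then have "ennreal a \<le> ennreal (cmod ((Y n - z) k))" by (rule ennreal_leI)
        also have "\<dots> \<le> N\<^sub>2 (Y n - z)" by (rule dom2)
        finally show ?thesis .
      qed
      \<comment> \<open>The remaining indices are finite in number, so positivity of each distance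
        suffices.\<close>
      have "\<exists>r>0. \<forall>y\<in>Y ` {..<n0} - {z}. ennreal r \<le> N\<^sub>2 (y - z)"
        by (rule finite_positive_lower_bound) (auto intro: pos)
      then obtain r where r: "r > 0" "\<And>n. n < n0 \<Longrightarrow> Y n \<noteq> z \<Longrightarrow> ennreal r \<le> N\<^sub>2 (Y n - z)"
        by blast
      have "ennreal (min r a) \<le> N\<^sub>2 (Y n - z)" if "Y n \<noteq> z" for n
        using r(2)[of n] far[of n] that by (cases "n < n0") (auto intro: ennreal_min_le)
      then show ?thesis using r a by (intro exI[of _ "min r a"]) auto
    qed
  qed
  then have "openin (quasinorm_topology N\<^sub>1) {x \<in> finite_part N\<^sub>1. x \<in> finite_part N\<^sub>2 - range Y}"
    using emb unfolding continuously_embedded_def continuous_map_def topspace_quasinorm_topology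
    by blast
  moreover have "(\<lambda>_. 0) \<in> {x \<in> finite_part N\<^sub>1. x \<in> finite_part N\<^sub>2 - range Y}"
  proof -
    have "Y n \<noteq> (\<lambda>_. 0)" for n using Y2[of n] zero(2) by (metis not_one_le_zero)
    then show ?thesis using zero by (auto simp: finite_part_def) metis
  qed
  ultimately have "\<exists>r>0. {y \<in> finite_part N\<^sub>1. N\<^sub>1 (y - (\<lambda>_. 0)) < ennreal r}
      \<subseteq> {x \<in> finite_part N\<^sub>1. x \<in> finite_part N\<^sub>2 - range Y}"
    unfolding openin_quasinorm_topology by (elim conjE bspec)
  then obtain r where r: "r > 0" "{y \<in> finite_part N\<^sub>1. N\<^sub>1 (y - (\<lambda>_. 0)) < ennreal r}
      \<subseteq> {x \<in> finite_part N\<^sub>1. x \<in> finite_part N\<^sub>2 - range Y}"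
    by (elim exE conjE)
  obtain n where n: "inverse (real (Suc n)) < r" using reals_Archimedean[OF r(1)] by blast
  have "N\<^sub>1 (Y n) < ennreal r"
    using Y1[of n] n r(1) by (auto simp: inverse_eq_divide intro!: le_less_trans[OF Y1[of n]] ennreal_lessI)
  moreover from this have "Y n \<in> finite_part N\<^sub>1"
    by (auto simp: finite_part_def intro: less_trans[OF _ ennreal_less_top])
  moreover have "Y n - (\<lambda>_. 0) = Y n" by (simp add: fun_eq_iff)
  ultimately have "Y n \<in> {x \<in> finite_part N\<^sub>1. x \<in> finite_part N\<^sub>2 - range Y}"
    by (intro subsetD[OF r(2)]) simp
  then show False by simp
qed

text \<open>Compactness would give the infinite set of unit sequences an accumulation point
  \<open>x\<close>, but any ball of small enough radius around a point meets that set in no other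
  point.\<close>

lemma not_compact_embedding:
  fixes N\<^sub>1 N\<^sub>2 :: "('a \<Rightarrow> complex) \<Rightarrow> ennreal"
  assumes inf: "infinite (UNIV :: 'a set)"
    and unit: "\<And>k. N\<^sub>1 (\<lambda>l. of_bool (l = k)) \<le> 1"
    and dom2: "\<And>x k. ennreal (cmod (x k)) \<le> N\<^sub>2 x"
  shows "\<not> compact_operator N\<^sub>1 N\<^sub>2 (\<lambda>x. x)"
proof
  assume comp: "compact_operator N\<^sub>1 N\<^sub>2 (\<lambda>x. x)"
  define e :: "'a \<Rightarrow> 'a \<Rightarrow> complex" where "e k = (\<lambda>l. of_bool (l = k))" for k
  define T where "T = range e"
  let ?X = "quasinorm_topology N\<^sub>2"
  have "inj e" by (rule injI) (metis e_def of_bool_eq_iff)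
  then have infT: "infinite T" using inf by (simp add: T_def finite_image_iff)
  have T1: "N\<^sub>1 x \<le> 1" if "x \<in> T" for x using that unit by (auto simp: T_def e_def)
  then have "T \<subseteq> finite_part N\<^sub>1" by (auto simp: finite_part_def intro: le_less_trans[of _ 1])
  then have Ttop: "T \<subseteq> topspace ?X"
    using comp by (auto simp: compact_operator_def topspace_quasinorm_topology)
  have "compactin ?X (?X closure_of T)"
    using comp T1 unfolding compact_operator_def by (metis image_ident ennreal_1)
  from compactin_imp_Bolzano_Weierstrass[OF this, of T] infT Ttop
  obtain x where x: "x \<in> ?X closure_of T" "x \<in> ?X derived_set_of T"
    using closure_of_subset by blast
  \<comment> \<open>Removing \<open>x\<close> from \<open>T\<close> makes this set a neighbourhood
    of \<open>x\<close> even if \<open>x\<close> is itself a unit sequence.\<close>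
  have "openin ?X (finite_part N\<^sub>2 - (T - {x}))"
  proof (rule openin_diff_separated)
    fix z :: "'a \<Rightarrow> complex"
    \<comment> \<open>Both sequences are compared with \<open>z\<close> in the single coordinate
      \<open>k\<close>, where the ordinary triangle inequality for complex numbers applies; distinct
      unit sequences differ there by 1.\<close>
    have close: "y = y'" if yT: "y \<in> T" "y' \<in> T" and near: "N\<^sub>2 (y - z) < ennreal (1/2)" "N\<^sub>2 (y' - z) < ennreal (1/2)"
      for y y'
    proof -
      obtain k k' where k: "y = e k" "y' = e k'" using yT by (auto simp: T_def)
      have "ennreal (cmod ((y - z) k)) < ennreal (1/2)" "ennreal (cmod ((y' - z) k)) < ennreal (1/2)"
        using near dom2 by (meson le_less_trans)+
      then have "cmod (y k - z k) < 1/2" "cmod (y' k - z k) < 1/2"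
        unfolding ennreal_less_iff[OF norm_ge_zero] by simp_all
      then have "cmod (y k - y' k) < 1"
        using norm_triangle_ineq4[of "y k - z k" "y' k - z k"] by simp
      then have "k = k'" by (cases "k = k'") (auto simp: k e_def)
      then show ?thesis by (simp add: k)
    qed
    let ?F = "{y \<in> T - {z}. N\<^sub>2 (y - z) < ennreal (1/2)}"
    have "finite ?F"
    proof (cases "?F = {}")
      case True
      then show ?thesis by (metis finite.emptyI)
    next
      case False
      then obtain y where "y \<in> ?F" by blast
      then have "?F \<subseteq> {y}" using close by blast
      then show ?thesis by (rule finite_subset) simp
    qed
    moreover have "0 < N\<^sub>2 (y - z)" if "y \<in> ?F" for y
    proof -
      from that obtain k where "y k \<noteq> z k" by blast
      then have "0 < ennreal (cmod ((y - z) k))" by simp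
      also have "\<dots> \<le> N\<^sub>2 (y - z)" by (rule dom2)
      finally show ?thesis .
    qed
    ultimately obtain r where r: "r > 0" "\<And>y. y \<in> ?F \<Longrightarrow> ennreal r \<le> N\<^sub>2 (y - z)"
      using finite_positive_lower_bound[of ?F "\<lambda>y. N\<^sub>2 (y - z)"] by blast
    have "ennreal (min r (1/2)) \<le> N\<^sub>2 (y - z)" if "y \<in> T" "y \<noteq> z" for y
      using r(2)[of y] that
      by (cases "N\<^sub>2 (y - z) < ennreal (1/2)") (auto simp: not_less intro: ennreal_min_le)
    then show "\<exists>r>0. \<forall>y\<in>T - {x}. y \<noteq> z \<longrightarrow> ennreal r \<le> N\<^sub>2 (y - z)"
      using r(1) by (intro exI[of _ "min r (1/2)"]) auto
  qed
  moreover have "x \<in> finite_part N\<^sub>2"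
    using x(1) by (metis in_closure_of topspace_quasinorm_topology)
  ultimately have "\<exists>y. y \<noteq> x \<and> y \<in> T \<and> y \<in> finite_part N\<^sub>2 - (T - {x})"
    using x(2)[unfolded in_derived_set_of, THEN conjunct2, rule_format,
      of "finite_part N\<^sub>2 - (T - {x})"] by simp
  then show False by blast
qed

section \<open>Counting lattice points in dyadic cubes\<close>

lemma int_div_eq_iff:
  fixes a q N :: int
  assumes "N > 0"
  shows "a div N = q \<longleftrightarrow> N * q \<le> a \<and> a < N * (q + 1)"
proof
  assume "a div N = q"
  then have "N * q + a mod N = a" by auto
  moreover have "0 \<le> a mod N" "a mod N < N" using assms by simp_all
  ultimately show "N * q \<le> a \<and> a < N * (q + 1)"
    unfolding distrib_left by linarith
next
  assume "N * q \<le> a \<and> a < N * (q + 1)"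
  then show "a div N = q"
    by (intro div_pos_neg_trivial int_div_pos_eq[of _ _ _ "a - N * q"]) (auto simp: algebra_simps)
qed

lemma card_vec_box:
  fixes A :: "'d::finite \<Rightarrow> 'a set"
  assumes "\<And>i. finite (A i)"
  shows "finite {k :: 'a ^ 'd. \<forall>i. k $ i \<in> A i}"
    and "card {k :: 'a ^ 'd. \<forall>i. k $ i \<in> A i} = (\<Prod>i\<in>UNIV. card (A i))"
proof -
  have eq: "{k :: 'a ^ 'd. \<forall>i. k $ i \<in> A i} = vec_lambda ` PiE UNIV A"
  proof (intro subset_antisym subsetI)
    fix k :: "'a ^ 'd" assume "k \<in> {k. \<forall>i. k $ i \<in> A i}"
    then show "k \<in> vec_lambda ` PiE UNIV A"
      by (intro image_eqI[of _ _ "vec_nth k"]) auto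
  qed auto
  have fin: "finite (PiE (UNIV :: 'd set) A)" using assms by (simp add: finite_PiE)
  show "finite {k :: 'a ^ 'd. \<forall>i. k $ i \<in> A i}" unfolding eq using fin by simp
  have "inj_on vec_lambda (PiE (UNIV :: 'd set) A)"
    by (rule inj_onI) (simp add: vec_lambda_inject)
  then show "card {k :: 'a ^ 'd. \<forall>i. k $ i \<in> A i} = (\<Prod>i\<in>UNIV. card (A i))"
    unfolding eq by (simp add: card_image card_PiE)
qed

text \<open>For \<open>s \<le> j\<close>, division by \<open>2 ^ s\<close> leaves an interval of
  \<open>2 ^ (j - s)\<close> integers. For \<open>s > j\<close>, a multiple of \<open>2 ^ s\<close>
  is one of \<open>2 ^ j\<close>, so only the left endpoint can occur; truncated subtraction makes
  the bound 1 in this case.\<close>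

lemma multiples_in_dyadic_interval:
  defines "A s j q \<equiv> {a :: int. 2 ^ s dvd a \<and> a div 2 ^ j = q}"
  shows "finite (A s j q)" and "card (A s j q) \<le> 2 ^ (j - s)"
    and "s \<le> j \<Longrightarrow> card (A s j q) = 2 ^ (j - s)"
proof -
  have le: "finite (A s j q) \<and> card (A s j q) = 2 ^ (j - s)" if "s \<le> j"
  proof -
    have split: "(2::int) ^ j = 2 ^ s * 2 ^ (j - s)" using that by (simp flip: power_add)
    have "A s j q = (*) (2 ^ s) ` {2 ^ (j - s) * q ..< 2 ^ (j - s) * (q + 1)}"
    proof (intro subset_antisym subsetI)
      fix a assume "a \<in> A s j q"
      then obtain b where "a = 2 ^ s * b" "a div 2 ^ j = q" by (auto simp: A_def)
      then show "a \<in> (*) (2 ^ s) ` {2 ^ (j - s) * q ..< 2 ^ (j - s) * (q + 1)}"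
        by (auto simp: split int_div_eq_iff)
    qed (auto simp: A_def split int_div_eq_iff)
    moreover have "inj_on ((*) ((2::int) ^ s)) S" for S by (rule inj_onI) simp
    ultimately show ?thesis by (simp add: card_image distrib_left nat_power_eq)
  qed
  have gt: "A s j q \<subseteq> {2 ^ j * q}" if "\<not> s \<le> j"
  proof
    fix a assume "a \<in> A s j q"
    moreover from this that have "2 ^ j dvd a"
      by (auto simp: A_def intro: dvd_trans[OF le_imp_power_dvd[of j s]])
    ultimately show "a \<in> {2 ^ j * q}" by (auto simp: A_def)
  qed
  show "s \<le> j \<Longrightarrow> card (A s j q) = 2 ^ (j - s)" using le by simp
  show "finite (A s j q)" using le gt finite_subset by blast
  show "card (A s j q) \<le> 2 ^ (j - s)"
    using le card_mono[OF _ gt] by (cases "s \<le> j") auto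
qed

text \<open>These are the points of the lattice of multiples of \<open>2 ^ s\<close> in the cube of
  side \<open>2 ^ j\<close> with index \<open>m\<close>; integer division encodes the half-open
  sides. The case \<open>s = 0\<close> gives all integer points of the cube.\<close>

definition lattice_cell :: "nat \<Rightarrow> nat \<Rightarrow> int ^ 'd \<Rightarrow> (int ^ 'd) set"
  where "lattice_cell s j m = {k. \<forall>i. k $ i \<in> {a. 2 ^ s dvd a \<and> a div 2 ^ j = m $ i}}"

lemma finite_lattice_cell: "finite (lattice_cell s j m)"
  unfolding lattice_cell_def by (intro card_vec_box multiples_in_dyadic_interval)

lemma card_lattice_cell_le: "card (lattice_cell s j (m :: int ^ 'd)) \<le> 2 ^ (CARD('d) * (j - s))"
proof -
  have "card (lattice_cell s j m) \<le> (\<Prod>i\<in>(UNIV :: 'd set). 2 ^ (j - s))"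
    unfolding lattice_cell_def
    by (subst card_vec_box) (auto intro!: prod_mono multiples_in_dyadic_interval simp del: prod_constant)
  then show ?thesis by (simp add: power_mult mult.commute[of "CARD('d)"])
qed

lemma card_lattice_cell:
  assumes "s \<le> j"
  shows "card (lattice_cell s j (m :: int ^ 'd)) = 2 ^ (CARD('d) * (j - s))"
  unfolding lattice_cell_def
  by (subst card_vec_box)
    (simp_all add: multiples_in_dyadic_interval assms power_mult mult.commute[of "CARD('d)"])

text \<open>A unit cube is contained as soon as its lower corner is: since the side is
  \<open>2 ^ j\<close>, the faces have integer coordinates, and \<open>k $ i\<close> below the upper
  one gives \<open>k $ i + 1\<close> at most equal to it.\<close>

lemma unit_cubes_in_dyadic_cube:
  "{k. dyadic_cube 0 k \<subseteq> dyadic_cube (- int j) (m :: int ^ 'd)} = lattice_cell 0 j m"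
proof -
  have "dyadic_cube 0 k \<subseteq> dyadic_cube (- int j) m \<longleftrightarrow> (\<forall>i. k $ i div 2 ^ j = m $ i)"
    (is "?L \<longleftrightarrow> ?R") for k :: "int ^ 'd"
  proof
    assume L: ?L
    have "(\<chi> i. real_of_int (k $ i)) \<in> dyadic_cube 0 k" by (simp add: mem_dyadic_cube)
    with L have mem: "(\<chi> i. real_of_int (k $ i)) \<in> dyadic_cube (- int j) m" by blast
    have "2 ^ j * m $ i \<le> k $ i \<and> k $ i < 2 ^ j * (m $ i + 1)" for i
    proof -
      have "real_of_int (2 ^ j * m $ i) \<le> real_of_int (k $ i)"
        "real_of_int (k $ i) < real_of_int (2 ^ j * (m $ i + 1))"
        using mem by (simp_all add: mem_dyadic_cube)
      then show ?thesis by linarith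
    qed
    then show ?R by (simp add: int_div_eq_iff)
  next
    assume R: ?R
    show ?L
    proof
      fix x assume x: "x \<in> dyadic_cube 0 k"
      have "2 ^ j * real_of_int (m $ i) \<le> x $ i \<and> x $ i < 2 ^ j * (real_of_int (m $ i) + 1)" for i
      proof -
        have "2 ^ j * m $ i \<le> k $ i" "k $ i + 1 \<le> 2 ^ j * (m $ i + 1)"
          using R[rule_format, of i] by (simp_all add: int_div_eq_iff)
        then have "real_of_int (2 ^ j * m $ i) \<le> real_of_int (k $ i)"
          "real_of_int (k $ i + 1) \<le> real_of_int (2 ^ j * (m $ i + 1))"
          unfolding of_int_le_iff by blast+
        moreover have "real_of_int (k $ i) \<le> x $ i" "x $ i < real_of_int (k $ i) + 1"
          using x by (simp_all add: mem_dyadic_cube)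
        ultimately show ?thesis by simp
      qed
      then show "x \<in> dyadic_cube (- int j) m" by (simp add: mem_dyadic_cube)
    qed
  qed
  then show ?thesis by (simp add: lattice_cell_def)
qed

section \<open>The Morrey norm as a supremum over lattice cells\<close>

lemma measure_dyadic_cube:
  "measure lborel (dyadic_cube (- int j) (m :: int ^ 'd)) = 2 powr (real j * CARD('d))"
proof -
  define a b :: "real ^ 'd" where "a = (\<chi> i. 2 ^ j * real_of_int (m $ i))"
    and "b = (\<chi> i. 2 ^ j * (real_of_int (m $ i) + 1))"
  let ?Q = "dyadic_cube (- int j) m"
  have Q: "?Q = (\<Inter>i. {x. a $ i \<le> x $ i}) \<inter> (\<Inter>i. {x. x $ i < b $ i})"
    by (auto simp: mem_dyadic_cube a_def b_def)
  have sets: "?Q \<in> sets lborel"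
    unfolding Q sets_lborel
    by (intro sets.Int borel_closed borel_open closed_INT open_INT ballI
      closed_Collect_le open_Collect_less continuous_intros) auto
  \<comment> \<open>The half-open cube is squeezed between an open and a closed box of equal
    volume.\<close>
  have sub: "box a b \<subseteq> ?Q" "?Q \<subseteq> cbox a b"
    unfolding Q by (auto simp: mem_box_cart less_imp_le)
  have ab: "b $ i - a $ i = 2 ^ j" "a $ i \<le> b $ i" for i
    by (simp_all add: a_def b_def algebra_simps)
  have "cbox a b \<noteq> {}" using ab by (auto simp: interval_ne_empty_cart)
  then have c: "measure lborel (cbox a b) = (2 ^ j) ^ CARD('d)"
    by (simp add: content_cbox_cart ab)
  have "measure lborel (box a b) \<le> measure lborel ?Q"
    using sub sets by (intro measure_mono_fmeasurable) (auto intro: fmeasurableI2[OF fmeasurable_cbox])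
  moreover have "measure lborel ?Q \<le> measure lborel (cbox a b)"
    using sub sets by (intro measure_mono_fmeasurable) auto
  ultimately have "measure lborel ?Q = (2 ^ j) ^ CARD('d)"
    using c ab by (simp add: measure_lborel_box_eq measure_lborel_cbox_eq)
  also have "\<dots> = 2 powr (real j * CARD('d))"
    by (simp add: powr_powr flip: powr_realpow)
  finally show ?thesis .
qed

lemma Morrey_norm_eq:
  "Morrey_norm u p (x :: int ^ 'd \<Rightarrow> complex) =
    (SUP j. SUP m. ennreal ((2 powr (real j * CARD('d))) powr (1 / u - 1 / p) *
      (\<Sum>k\<in>lattice_cell 0 j m. cmod (x k) powr p) powr (1 / p)))"
  unfolding Morrey_norm_def measure_dyadic_cube unit_cubes_in_dyadic_cube ..

lemma Morrey_norm_upper: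
  "ennreal ((2 powr (real j * CARD('d))) powr (1 / u - 1 / p) *
    (\<Sum>k\<in>lattice_cell 0 j m. cmod (x k) powr p) powr (1 / p))
    \<le> Morrey_norm u p (x :: int ^ 'd \<Rightarrow> complex)"
  unfolding Morrey_norm_eq by (meson SUP_upper UNIV_I order_trans)

lemma Morrey_norm_le:
  assumes "\<And>j m. (2 powr (real j * CARD('d))) powr (1 / u - 1 / p) *
    (\<Sum>k\<in>lattice_cell 0 j m. cmod (x k) powr p) powr (1 / p) \<le> c"
  shows "Morrey_norm u p (x :: int ^ 'd \<Rightarrow> complex) \<le> ennreal c"
  unfolding Morrey_norm_eq using assms by (intro SUP_least ennreal_leI)

lemma cmod_le_Morrey_norm:
  assumes "p > 0"
  shows "ennreal (cmod (x k)) \<le> Morrey_norm u p (x :: int ^ 'd \<Rightarrow> complex)"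
proof -
  have "lattice_cell 0 0 k = {k}" by (auto simp: lattice_cell_def vec_eq_iff)
  then show ?thesis
    using Morrey_norm_upper[where j = 0 and m = k and x = x and u = u and p = p] assms by (simp add: powr_powr)
qed

section \<open>Sufficiency: power means and the change of exponents on a cube\<close>

lemma sum_powr_le:
  fixes y :: "'a \<Rightarrow> real"
  assumes "finite S" "\<And>i. i \<in> S \<Longrightarrow> 0 \<le> y i" "1 \<le> q"
  shows "(\<Sum>i\<in>S. y i) powr q \<le> real (card S) powr (q - 1) * (\<Sum>i\<in>S. y i powr q)"
proof -
  \<comment> \<open>Terms equal to 0 are dropped, so that convexity of \<open>powr\<close> is
    applied only at positive arguments.\<close>
  define P where "P = {i \<in> S. 0 < y i}"
  have P: "finite P" "P \<subseteq> S" using assms(1) by (auto simp: P_def)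
  have zero: "y i = 0" if "i \<in> S - P" for i using that assms(2)[of i] by (auto simp: P_def)
  have sums: "(\<Sum>i\<in>S. y i) = (\<Sum>i\<in>P. y i)" "(\<Sum>i\<in>S. y i powr q) = (\<Sum>i\<in>P. y i powr q)"
    using assms(1) P zero by (auto intro!: sum.mono_neutral_right)
  show ?thesis
  proof (cases "P = {}")
    case True
    then show ?thesis by (simp add: sums)
  next
    case False
    define n where "n = real (card P)"
    have n: "n > 0" using False P by (simp add: n_def card_gt_0_iff)
    have "(\<Sum>i\<in>P. (1 / n) *\<^sub>R y i) powr q \<le> (\<Sum>i\<in>P. (1 / n) * y i powr q)"
      using False P n assms(3)
      by (intro convex_on_sum[OF _ _ powr_convex]) (auto simp: P_def n_def)
    then have "((\<Sum>i\<in>P. y i) / n) powr q \<le> (\<Sum>i\<in>P. y i powr q) / n"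
      by (simp add: sum_divide_distrib)
    moreover have "0 \<le> (\<Sum>i\<in>P. y i)" by (auto simp: P_def intro: sum_nonneg)
    ultimately have "(\<Sum>i\<in>P. y i) powr q \<le> n powr (q - 1) * (\<Sum>i\<in>P. y i powr q)"
      using n by (simp add: powr_divide powr_diff field_simps)
    also have "\<dots> \<le> real (card S) powr (q - 1) * (\<Sum>i\<in>P. y i powr q)"
      using P assms(1,3) by (intro mult_right_mono powr_mono2 sum_nonneg) (auto simp: n_def card_mono)
    finally show ?thesis by (simp add: sums)
  qed
qed

text \<open>The estimate on a single cube: \<open>card S\<close> stands for its volume, and
  \<open>c\<close> bounds both the entries and the first Morrey term.\<close>

lemma Morrey_term_mono:
  fixes a :: "'a \<Rightarrow> real"
  assumes p: "0 < p\<^sub>1" "p\<^sub>1 \<le> u\<^sub>1" "0 < p\<^sub>2" "p\<^sub>2 \<le> u\<^sub>2"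
    and u: "u\<^sub>1 \<le> u\<^sub>2" "p\<^sub>2 / u\<^sub>2 \<le> p\<^sub>1 / u\<^sub>1"
    and S: "finite S" "S \<noteq> {}"
    and a: "\<And>k. k \<in> S \<Longrightarrow> 0 \<le> a k" "\<And>k. k \<in> S \<Longrightarrow> a k \<le> c"
    and le: "real (card S) powr (1 / u\<^sub>1 - 1 / p\<^sub>1) * (\<Sum>k\<in>S. a k powr p\<^sub>1) powr (1 / p\<^sub>1) \<le> c"
  shows "real (card S) powr (1 / u\<^sub>2 - 1 / p\<^sub>2) * (\<Sum>k\<in>S. a k powr p\<^sub>2) powr (1 / p\<^sub>2) \<le> c"
proof -
  define V where "V = real (card S)"
  have V: "V > 0" using S by (simp add: V_def card_gt_0_iff)
  have c0: "0 \<le> c" using S a by force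
  show ?thesis
  proof (cases "c = 0")
    case True
    then have "a k = 0" if "k \<in> S" for k using a[OF that] by simp
    then show ?thesis using True p by simp
  next
    case False
    with c0 have c: "c > 0" by simp
    define p where "p = p\<^sub>1 * u\<^sub>2 / u\<^sub>1"
    have p1: "p\<^sub>1 \<le> p" using p u by (simp add: p_def field_simps)
    have p2: "p\<^sub>2 \<le> p" using p u by (simp add: p_def field_simps)
    define q where "q = p / p\<^sub>2"
    have q: "1 \<le> q" using p2 p by (simp add: q_def)
    define S1 where "S1 = (\<Sum>k\<in>S. a k powr p\<^sub>1)"
    have S1: "0 \<le> S1" by (simp add: S1_def sum_nonneg)
    have "(V powr (1 / u\<^sub>1 - 1 / p\<^sub>1) * S1 powr (1 / p\<^sub>1)) powr p\<^sub>1 \<le> c powr p\<^sub>1"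
      using le p by (intro powr_mono2) (auto simp: V_def S1_def)
    moreover have "(1 / u\<^sub>1 - 1 / p\<^sub>1) * p\<^sub>1 = p\<^sub>1 / u\<^sub>1 - 1"
      using p by (simp add: left_diff_distrib)
    ultimately have "V powr (p\<^sub>1 / u\<^sub>1 - 1) * S1 \<le> c powr p\<^sub>1"
      using p S1 by (simp add: powr_mult powr_powr)
    then have S1_le: "S1 \<le> c powr p\<^sub>1 * V powr (1 - p\<^sub>1 / u\<^sub>1)"
      using V by (simp add: powr_diff field_simps)
    have "(\<Sum>k\<in>S. a k powr p) \<le> (\<Sum>k\<in>S. c powr (p - p\<^sub>1) * a k powr p\<^sub>1)"
    proof (rule sum_mono)
      fix k assume "k \<in> S"
      \<comment> \<open>This also holds for \<open>a k = 0\<close> and \<open>p = p\<^sub>1\<close>,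
        because \<open>0 powr 0 = 0\<close>.\<close>
      have "a k powr p = a k powr (p - p\<^sub>1) * a k powr p\<^sub>1" by (simp flip: powr_add)
      also have "\<dots> \<le> c powr (p - p\<^sub>1) * a k powr p\<^sub>1"
        using a \<open>k \<in> S\<close> p1 by (intro mult_right_mono powr_mono2) auto
      finally show "a k powr p \<le> c powr (p - p\<^sub>1) * a k powr p\<^sub>1" .
    qed
    also have "\<dots> = c powr (p - p\<^sub>1) * S1" by (simp add: S1_def sum_distrib_left)
    also have "\<dots> \<le> c powr (p - p\<^sub>1) * (c powr p\<^sub>1 * V powr (1 - p\<^sub>1 / u\<^sub>1))"
      using S1_le by (intro mult_left_mono) auto
    also have "\<dots> = c powr p * V powr (1 - p\<^sub>1 / u\<^sub>1)"
      by (simp flip: powr_add mult.assoc)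
    finally have sum_p: "(\<Sum>k\<in>S. a k powr p) \<le> c powr p * V powr (1 - p\<^sub>1 / u\<^sub>1)" .
    define S2 where "S2 = (\<Sum>k\<in>S. a k powr p\<^sub>2)"
    have S2: "0 \<le> S2" by (simp add: S2_def sum_nonneg)
    have "S2 powr q \<le> V powr (q - 1) * (\<Sum>k\<in>S. (a k powr p\<^sub>2) powr q)"
      unfolding S2_def V_def using S q by (intro sum_powr_le) auto
    also have "(\<Sum>k\<in>S. (a k powr p\<^sub>2) powr q) = (\<Sum>k\<in>S. a k powr p)"
      using p by (simp add: powr_powr q_def)
    also have "V powr (q - 1) * \<dots> \<le> V powr (q - 1) * (c powr p * V powr (1 - p\<^sub>1 / u\<^sub>1))"
      using sum_p by (intro mult_left_mono) auto
    also have "\<dots> = c powr p * V powr (q - p\<^sub>1 / u\<^sub>1)"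
      by (simp add: mult.left_commute flip: powr_add)
    finally have "(S2 powr q) powr (1 / p) \<le> (c powr p * V powr (q - p\<^sub>1 / u\<^sub>1)) powr (1 / p)"
      using p1 p by (intro powr_mono2) auto
    also have "\<dots> = c * V powr ((q - p\<^sub>1 / u\<^sub>1) / p)"
      using p1 p c by (simp add: powr_mult powr_powr)
    \<comment> \<open>Here \<open>p\<^sub>1 / u\<^sub>1 = p / u\<^sub>2\<close> enters: the power of
      the volume exactly cancels the factor in front of the second Morrey term.\<close>
    also have "(q - p\<^sub>1 / u\<^sub>1) / p = 1 / p\<^sub>2 - 1 / u\<^sub>2"
      using p by (simp add: q_def p_def field_simps)
    also have "(S2 powr q) powr (1 / p) = S2 powr (1 / p\<^sub>2)"
      using p p1 by (simp add: powr_powr q_def)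
    finally show ?thesis
      using V by (simp add: S2_def V_def powr_diff field_simps)
  qed
qed

lemma card_unit_cubes: "real (card (lattice_cell 0 j (m :: int ^ 'd))) = 2 powr (real j * CARD('d))"
  by (simp add: card_lattice_cell mult.commute flip: powr_realpow)

text \<open>A finite first norm itself serves as \<open>c\<close> on every cube, so the embedding
  constant is 1.\<close>

lemma Morrey_norm_mono:
  assumes "0 < p\<^sub>1" "p\<^sub>1 \<le> u\<^sub>1" "0 < p\<^sub>2" "p\<^sub>2 \<le> u\<^sub>2" "u\<^sub>1 \<le> u\<^sub>2" "p\<^sub>2 / u\<^sub>2 \<le> p\<^sub>1 / u\<^sub>1"
  shows "Morrey_norm u\<^sub>2 p\<^sub>2 (x :: int ^ 'd \<Rightarrow> complex) \<le> Morrey_norm u\<^sub>1 p\<^sub>1 x"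
proof (cases "Morrey_norm u\<^sub>1 p\<^sub>1 x")
  case (real c)
  have "Morrey_norm u\<^sub>2 p\<^sub>2 x \<le> ennreal c"
  proof (rule Morrey_norm_le)
    fix j and m :: "int ^ 'd"
    have "lattice_cell 0 j m \<noteq> {}"
      using card_unit_cubes[of j m] by force
    moreover have "cmod (x k) \<le> c" for k
      using cmod_le_Morrey_norm[OF assms(1), of x k u\<^sub>1] real by simp
    moreover have "(2 powr (real j * CARD('d))) powr (1 / u\<^sub>1 - 1 / p\<^sub>1) *
        (\<Sum>k\<in>lattice_cell 0 j m. cmod (x k) powr p\<^sub>1) powr (1 / p\<^sub>1) \<le> c"
      using Morrey_norm_upper[of j u\<^sub>1 p\<^sub>1 x m] real by simp
    ultimately show "(2 powr (real j * CARD('d))) powr (1 / u\<^sub>2 - 1 / p\<^sub>2) *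
        (\<Sum>k\<in>lattice_cell 0 j m. cmod (x k) powr p\<^sub>2) powr (1 / p\<^sub>2) \<le> c"
      using Morrey_term_mono[OF assms finite_lattice_cell, of 0 j m "\<lambda>k. cmod (x k)" c]
      by (simp add: card_unit_cubes)
  qed
  then show ?thesis by (simp add: real)
qed simp

section \<open>Test sequences and necessity of the two conditions\<close>

definition lattice_bump :: "nat \<Rightarrow> nat \<Rightarrow> real \<Rightarrow> int ^ 'd \<Rightarrow> complex"
  where "lattice_bump s n t k = of_real t * of_bool (k \<in> lattice_cell s n 0)"

lemma Morrey_sum_lattice_bump:
  fixes m :: "int ^ 'd"
  assumes "0 < p" "0 \<le> t"
  shows "(\<Sum>k\<in>lattice_cell 0 j m. cmod (lattice_bump s n t k) powr p) powr (1 / p) =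
    t * real (card (lattice_cell 0 j m \<inter> lattice_cell s n 0)) powr (1 / p)"
proof -
  have "cmod (lattice_bump s n t k) powr p = (if k \<in> lattice_cell s n 0 then t powr p else 0)"
    for k :: "int ^ 'd"
    using assms by (simp add: lattice_bump_def norm_mult)
  then have "(\<Sum>k\<in>lattice_cell 0 j m. cmod (lattice_bump s n t k) powr p) =
      t powr p * real (card (lattice_cell 0 j m \<inter> lattice_cell s n 0))"
    by (simp add: finite_lattice_cell flip: sum.inter_restrict)
  then show ?thesis using assms by (simp add: powr_mult powr_powr)
qed

text \<open>A cube of side \<open>2 ^ j\<close> meets the support in at most
  \<open>2 ^ (CARD('d) * (i - s))\<close> points, where \<open>i = min j n\<close>. Since
  \<open>1 / u - 1 / p \<le> 0\<close>, replacing \<open>j\<close> by \<open>i\<close> in the volume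
  factor only enlarges the term. For \<open>i \<le> s\<close> the exponent is then at most 0;
  otherwise it is \<open>i / u - s / p\<close>, which increases with \<open>i\<close>.\<close>

lemma Morrey_norm_lattice_bump_le:
  assumes "0 < p" "p \<le> u" "0 \<le> t"
  shows "Morrey_norm u p (lattice_bump s n t :: int ^ 'd \<Rightarrow> complex) \<le>
    ennreal (t * 2 powr (CARD('d) * max 0 (real n / u - real s / p)))"
proof (rule Morrey_norm_le)
  fix j and m :: "int ^ 'd"
  define D where "D = real CARD('d)"
  define i where "i = min j n"
  let ?C = "lattice_cell 0 j m \<inter> lattice_cell s n 0"
  have "?C \<subseteq> lattice_cell s j m" by (auto simp: lattice_cell_def)
  then have "card ?C \<le> card (lattice_cell s j m)" "card ?C \<le> card (lattice_cell s n (0 :: int ^ 'd))"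
    by (auto intro!: card_mono finite_lattice_cell)
  then have "card ?C \<le> 2 ^ (CARD('d) * (i - s))"
    using card_lattice_cell_le[of s j m] card_lattice_cell_le[of s n "0 :: int ^ 'd"]
    by (auto simp: i_def min_def)
  then have "real (card ?C) \<le> 2 ^ (CARD('d) * (i - s))"
    by (metis of_nat_le_iff of_nat_numeral of_nat_power)
  then have card: "real (card ?C) \<le> 2 powr (D * real (i - s))"
    by (simp add: D_def flip: powr_realpow)
  have exponent: "real j * (1 / u - 1 / p) + real (i - s) / p \<le> max 0 (real n / u - real s / p)"
  proof -
    have "1 / u - 1 / p \<le> 0" using assms by (simp add: frac_le)
    then have "real j * (1 / u - 1 / p) \<le> real i * (1 / u - 1 / p)"
      by (intro mult_right_mono_neg) (simp_all add: i_def)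
    moreover have "real i * (1 / u - 1 / p) + real (i - s) / p \<le> max 0 (real n / u - real s / p)"
    proof (cases "i \<le> s")
      case True
      then show ?thesis
        using \<open>1 / u - 1 / p \<le> 0\<close> by (simp add: mult_nonneg_nonpos le_max_iff_disj)
    next
      case False
      then have "real i * (1 / u - 1 / p) + real (i - s) / p = real i / u - real s / p"
        by (simp add: of_nat_diff right_diff_distrib diff_divide_distrib)
      also have "\<dots> \<le> real n / u - real s / p"
        using assms by (simp add: i_def divide_right_mono)
      finally show ?thesis by simp
    qed
    ultimately show ?thesis by simp
  qed
  have "(2 powr (real j * D)) powr (1 / u - 1 / p) * (t * real (card ?C) powr (1 / p)) \<le>
      (2 powr (real j * D)) powr (1 / u - 1 / p) * (t * (2 powr (D * real (i - s))) powr (1 / p))"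
    using card assms by (intro mult_left_mono powr_mono2) auto
  also have "\<dots> = t * 2 powr (D * (real j * (1 / u - 1 / p) + real (i - s) / p))"
    by (simp add: powr_powr algebra_simps flip: powr_add)
  also have "\<dots> \<le> t * 2 powr (D * max 0 (real n / u - real s / p))"
    using exponent assms by (intro mult_left_mono powr_mono) (auto simp: D_def)
  finally show "(2 powr (real j * CARD('d))) powr (1 / u - 1 / p) *
      (\<Sum>k\<in>lattice_cell 0 j m. cmod (lattice_bump s n t k) powr p) powr (1 / p) \<le>
      t * 2 powr (CARD('d) * max 0 (real n / u - real s / p))"
    using assms by (simp add: Morrey_sum_lattice_bump D_def)
qed

text \<open>The bound is the term of the cube that carries the support, with \<open>j = n\<close>
  and \<open>m = 0\<close>.\<close>

lemma Morrey_norm_lattice_bump_ge: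
  assumes "0 < p" "0 \<le> t" "s \<le> n"
  shows "ennreal (t * 2 powr (CARD('d) * (real n / u - real s / p))) \<le>
    Morrey_norm u p (lattice_bump s n t :: int ^ 'd \<Rightarrow> complex)"
proof -
  have "lattice_cell 0 n 0 \<inter> lattice_cell s n 0 = lattice_cell s n (0 :: int ^ 'd)"
    by (auto simp: lattice_cell_def)
  moreover have "real (card (lattice_cell s n (0 :: int ^ 'd))) = 2 powr (CARD('d) * (real n - real s))"
    using assms by (simp add: card_lattice_cell of_nat_diff flip: powr_realpow)
  ultimately have "(2 powr (real n * CARD('d))) powr (1 / u - 1 / p) *
      (\<Sum>k\<in>lattice_cell 0 n 0. cmod (lattice_bump s n t (k :: int ^ 'd)) powr p) powr (1 / p) =
      t * 2 powr (CARD('d) * (real n / u - real s / p))"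
    using assms
    by (simp add: Morrey_sum_lattice_bump powr_powr algebra_simps diff_divide_distrib flip: powr_add)
  then show ?thesis
    using Morrey_norm_upper[of n u p "lattice_bump s n t :: int ^ 'd \<Rightarrow> complex" 0] by simp
qed

lemma Morrey_norm_zero: "Morrey_norm u p (\<lambda>_. 0) = 0"
  by (simp add: Morrey_norm_eq)

text \<open>The volume factor is at most 1, since cubes have volume at least 1 and
  \<open>p \<le> u\<close>; the sum is 0 or 1.\<close>

lemma Morrey_norm_unit_sequence:
  assumes "0 < p" "p \<le> u"
  shows "Morrey_norm u p (\<lambda>l :: int ^ 'd. of_bool (l = k)) \<le> 1"
proof -
  have "(2 powr (real j * CARD('d))) powr (1 / u - 1 / p) *
      (\<Sum>l\<in>lattice_cell 0 j m. cmod (of_bool (l = k)) powr p) powr (1 / p) \<le> 1" for j m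
  proof (rule mult_le_one)
    have "real j * CARD('d) * (1 / u - 1 / p) \<le> 0"
      using assms by (intro mult_nonneg_nonpos) (auto simp: frac_le)
    then show "(2 powr (real j * CARD('d))) powr (1 / u - 1 / p) \<le> 1"
      using powr_mono[of _ 0 "2::real"] by (simp add: powr_powr)
    have "cmod (of_bool (l = k)) powr p = of_bool (l = k)" for l by simp
    then have "(\<Sum>l\<in>lattice_cell 0 j m. cmod (of_bool (l = k)) powr p) =
        of_bool (k \<in> lattice_cell 0 j m)"
      by (simp add: of_bool_def finite_lattice_cell)
    then show "(\<Sum>l\<in>lattice_cell 0 j m. cmod (of_bool (l = k)) powr p) powr (1 / p) \<le> 1"
      by simp
  qed simp
  then show ?thesis using Morrey_norm_le[of u p "\<lambda>l :: int ^ 'd. of_bool (l = k)" 1] by simp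
qed

text \<open>Up to the factor \<open>CARD('d)\<close>, the gap is the binary logarithm of the
  quotient of the lower bound for the second norm by the upper bound for the first. A gap of
  \<open>log 2 (Suc N)\<close> yields a quotient of at least \<open>Suc N\<close>, as the dimension
  is at least 1.\<close>

lemma not_embedded_if_exponent_gap:
  assumes "0 < p\<^sub>1" "p\<^sub>1 \<le> u\<^sub>1" "0 < p\<^sub>2"
    and gap: "\<And>K :: real. \<exists>n s. s \<le> n \<and>
      K \<le> (real n / u\<^sub>2 - real s / p\<^sub>2) - max 0 (real n / u\<^sub>1 - real s / p\<^sub>1)"
  shows "\<not> continuously_embedded
    (Morrey_norm u\<^sub>1 p\<^sub>1 :: (int ^ 'd \<Rightarrow> complex) \<Rightarrow> ennreal) (Morrey_norm u\<^sub>2 p\<^sub>2)"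
proof (rule not_continuously_embedded)
  fix N :: nat
  define D where "D = real CARD('d)"
  obtain n s where s: "s \<le> n"
    and K: "log 2 (Suc N) \<le> (real n / u\<^sub>2 - real s / p\<^sub>2) - max 0 (real n / u\<^sub>1 - real s / p\<^sub>1)"
    using gap by blast
  define g where "g = real n / u\<^sub>2 - real s / p\<^sub>2"
  define h where "h = max 0 (real n / u\<^sub>1 - real s / p\<^sub>1)"
  \<comment> \<open>This height normalises the lower bound for the second norm to 1.\<close>
  define t where "t = 2 powr (- (D * g))"
  have "0 \<le> log 2 (Suc N)" by simp
  with K have nonneg: "0 \<le> g - h" unfolding g_def h_def by (rule order_trans[rotated])
  have "1 \<le> D" by (simp add: D_def Suc_le_eq)
  with nonneg have "1 * (g - h) \<le> D * (g - h)" by (intro mult_right_mono)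
  with K have "log 2 (Suc N) \<le> D * (g - h)" by (simp only: g_def h_def mult_1 order_trans)
  then have "2 powr (- (D * (g - h))) \<le> 2 powr (- log 2 (Suc N))"
    by (intro powr_mono) auto
  also have "\<dots> = 1 / Suc N" by (simp add: powr_minus_divide)
  finally have "t * 2 powr (D * h) \<le> 1 / Suc N"
    by (simp add: t_def algebra_simps flip: powr_add)
  then have "ennreal (t * 2 powr (D * h)) \<le> ennreal (1 / Suc N)" by (rule ennreal_leI)
  moreover have "Morrey_norm u\<^sub>1 p\<^sub>1 (lattice_bump s n t :: int ^ 'd \<Rightarrow> complex) \<le>
      ennreal (t * 2 powr (D * h))"
    using Morrey_norm_lattice_bump_le[OF assms(1,2), where ?'d = 'd, of t s n]
    by (simp add: t_def D_def h_def)
  ultimately have "Morrey_norm u\<^sub>1 p\<^sub>1 (lattice_bump s n t :: int ^ 'd \<Rightarrow> complex) \<le>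
      ennreal (1 / Suc N)"
    by (rule order_trans[rotated])
  moreover have "1 \<le> Morrey_norm u\<^sub>2 p\<^sub>2 (lattice_bump s n t :: int ^ 'd \<Rightarrow> complex)"
    using Morrey_norm_lattice_bump_ge[OF assms(3) _ s, where ?'d = 'd, of t u\<^sub>2]
    by (simp add: t_def D_def g_def flip: powr_add)
  ultimately show "\<exists>y :: int ^ 'd \<Rightarrow> complex. Morrey_norm u\<^sub>1 p\<^sub>1 y \<le> ennreal (1 / Suc N) \<and> 1 \<le> Morrey_norm u\<^sub>2 p\<^sub>2 y"
    by blast
qed (use assms in \<open>auto intro: cmod_le_Morrey_norm Morrey_norm_zero\<close>)

text \<open>Indicators of full cubes, \<open>s = 0\<close>, have the gap
  \<open>n * (1 / u\<^sub>2 - 1 / u\<^sub>1)\<close>.\<close>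

lemma embedded_imp_u_le:
  assumes "0 < p\<^sub>1" "p\<^sub>1 \<le> u\<^sub>1" "0 < p\<^sub>2" "p\<^sub>2 \<le> u\<^sub>2"
    and "continuously_embedded
      (Morrey_norm u\<^sub>1 p\<^sub>1 :: (int ^ 'd \<Rightarrow> complex) \<Rightarrow> ennreal) (Morrey_norm u\<^sub>2 p\<^sub>2)"
  shows "u\<^sub>1 \<le> u\<^sub>2"
proof (rule ccontr)
  assume "\<not> u\<^sub>1 \<le> u\<^sub>2"
  then have \<delta>: "0 < 1 / u\<^sub>2 - 1 / u\<^sub>1" using assms by (simp add: frac_less2)
  have "\<exists>n s. s \<le> n \<and> K \<le> (real n / u\<^sub>2 - real s / p\<^sub>2) - max 0 (real n / u\<^sub>1 - real s / p\<^sub>1)" for K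
  proof -
    obtain n where "K < real n * (1 / u\<^sub>2 - 1 / u\<^sub>1)" using ex_less_of_nat_mult[OF \<delta>] by blast
    then show ?thesis
      using assms by (intro exI[of _ n] exI[of _ 0]) (simp add: right_diff_distrib)
  qed
  then show False using not_embedded_if_exponent_gap assms by blast
qed

text \<open>The lattice is thinned just enough for
  \<open>n / u\<^sub>1 - s / p\<^sub>1 \<le> 0\<close>, so the maximum vanishes and the gap is
  \<open>n / u\<^sub>2 - s / p\<^sub>2\<close>, which grows linearly in \<open>n\<close>.\<close>

lemma embedded_imp_ratio_le:
  assumes "0 < p\<^sub>1" "p\<^sub>1 \<le> u\<^sub>1" "0 < p\<^sub>2" "p\<^sub>2 \<le> u\<^sub>2"
    and "continuously_embedded
      (Morrey_norm u\<^sub>1 p\<^sub>1 :: (int ^ 'd \<Rightarrow> complex) \<Rightarrow> ennreal) (Morrey_norm u\<^sub>2 p\<^sub>2)"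
  shows "p\<^sub>2 / u\<^sub>2 \<le> p\<^sub>1 / u\<^sub>1"
proof (rule ccontr)
  define \<theta> where "\<theta> = p\<^sub>1 / u\<^sub>1"
  have \<theta>: "0 < \<theta>" "\<theta> \<le> 1" using assms by (simp_all add: \<theta>_def)
  assume "\<not> p\<^sub>2 / u\<^sub>2 \<le> p\<^sub>1 / u\<^sub>1"
  then have \<delta>: "0 < 1 / u\<^sub>2 - \<theta> / p\<^sub>2" using assms by (simp add: \<theta>_def field_simps)
  have "\<exists>n s. s \<le> n \<and> K \<le> (real n / u\<^sub>2 - real s / p\<^sub>2) - max 0 (real n / u\<^sub>1 - real s / p\<^sub>1)" for K
  proof -
    \<comment> \<open>The extra \<open>1 / p\<^sub>2\<close> pays for rounding
      \<open>n * \<theta>\<close> up to the integer \<open>s\<close>.\<close>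
    obtain n where n: "K + 1 / p\<^sub>2 < real n * (1 / u\<^sub>2 - \<theta> / p\<^sub>2)" using ex_less_of_nat_mult[OF \<delta>] by blast
    define s where "s = nat \<lceil>real n * \<theta>\<rceil>"
    have s: "real n * \<theta> \<le> real s" "real s \<le> real n * \<theta> + 1"
      using \<theta> by (simp_all add: s_def of_nat_nat ceiling_le_iff)
    have "s \<le> n"
      using \<theta> by (simp add: s_def nat_le_iff ceiling_le_iff mult_left_le)
    moreover have "real n / u\<^sub>1 - real s / p\<^sub>1 \<le> 0"
      using s(1) assms by (simp add: \<theta>_def field_simps)
    moreover have "real s / p\<^sub>2 \<le> (real n * \<theta> + 1) / p\<^sub>2"
      using s(2) assms by (intro divide_right_mono) auto
    ultimately show ?thesis
      using n by (intro exI[of _ n] exI[of _ s]) (simp add: right_diff_distrib add_divide_distrib)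
  qed
  then show False using not_embedded_if_exponent_gap assms by blast
qed

lemma infinite_int_vec: "infinite (UNIV :: (int ^ 'd) set)"
proof -
  have "inj (\<lambda>a :: int. (\<chi> i. a) :: int ^ 'd)" by (rule injI) (simp add: vec_eq_iff)
  then have "infinite (range (\<lambda>a :: int. (\<chi> i. a) :: int ^ 'd))"
    by (simp add: finite_image_iff)
  then show ?thesis by (rule contrapos_nn) (rule finite_subset[OF subset_UNIV])
qed

theorem theorem2p1:
  fixes p\<^sub>1 u\<^sub>1 p\<^sub>2 u\<^sub>2 :: real
  assumes "0 < p\<^sub>1" "p\<^sub>1 \<le> u\<^sub>1" "0 < p\<^sub>2" "p\<^sub>2 \<le> u\<^sub>2"
  shows "(continuously_embedded
            (Morrey_norm u\<^sub>1 p\<^sub>1 :: (int ^ 'd \<Rightarrow> complex) \<Rightarrow> ennreal) (Morrey_norm u\<^sub>2 p\<^sub>2) \<longleftrightarrow>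
          u\<^sub>1 \<le> u\<^sub>2 \<and> p\<^sub>2 / u\<^sub>2 \<le> p\<^sub>1 / u\<^sub>1) \<and>
         (continuously_embedded
            (Morrey_norm u\<^sub>1 p\<^sub>1 :: (int ^ 'd \<Rightarrow> complex) \<Rightarrow> ennreal) (Morrey_norm u\<^sub>2 p\<^sub>2) \<longrightarrow>
          \<not> compact_operator
            (Morrey_norm u\<^sub>1 p\<^sub>1 :: (int ^ 'd \<Rightarrow> complex) \<Rightarrow> ennreal) (Morrey_norm u\<^sub>2 p\<^sub>2) (\<lambda>x. x))"
proof (intro conjI iffI impI)
  assume emb: "continuously_embedded
    (Morrey_norm u\<^sub>1 p\<^sub>1 :: (int ^ 'd \<Rightarrow> complex) \<Rightarrow> ennreal) (Morrey_norm u\<^sub>2 p\<^sub>2)"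
  show "u\<^sub>1 \<le> u\<^sub>2" using assms emb by (rule embedded_imp_u_le)
  show "p\<^sub>2 / u\<^sub>2 \<le> p\<^sub>1 / u\<^sub>1" using assms emb by (rule embedded_imp_ratio_le)
next
  assume "u\<^sub>1 \<le> u\<^sub>2 \<and> p\<^sub>2 / u\<^sub>2 \<le> p\<^sub>1 / u\<^sub>1"
  then show "continuously_embedded
    (Morrey_norm u\<^sub>1 p\<^sub>1 :: (int ^ 'd \<Rightarrow> complex) \<Rightarrow> ennreal) (Morrey_norm u\<^sub>2 p\<^sub>2)"
    using assms by (intro continuously_embedded_if_le Morrey_norm_mono) auto
next
  show "\<not> compact_operator
    (Morrey_norm u\<^sub>1 p\<^sub>1 :: (int ^ 'd \<Rightarrow> complex) \<Rightarrow> ennreal) (Morrey_norm u\<^sub>2 p\<^sub>2) (\<lambda>x. x)"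
    using assms
    by (intro not_compact_embedding infinite_int_vec Morrey_norm_unit_sequence cmod_le_Morrey_norm)
qed

end
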